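(* Let $m\ge 0$ and $n>m$ be integers, let $K>0$, and let $z=(z_1,\dots,z_m)\in\mathbb{C}^m$ be a list of complex numbers closed under complex conjugation (with multiplicity) such that $z_i\notin[0,+\infty)$ for all $i$. Write $B(s)=K\prod_{i=1}^m(s-z_i)=\sum_{i=0}^n b_i s^{n-i}$ (so $b_i=0$ for $0\le i\le n-m-1$), and define $$\tilde B(s)=\sum_{i=1}^n \frac{b_i}{(i-1)!}\,s^{n-i}.$$ Then the following are equivalent: (a) there exist closed-loop poles $p=(p_1,\dots,p_n)\in\mathbb{C}^n$, closed under complex conjugation (with multiplicity), such that the transfer function $H(s)=B(s)/\prod_{i=1}^n(s-p_i)$ is stable and externally positive; (b) the polynomial $\tilde B$ has no real non-negative roots.
   Context: All transfer functions have real coefficients. The transfer function $H(s)=B(s)/\prod_{i=1}^n(s-p_i)$ is called stable if $\operatorname{Re}(p_i)<0$ for all $i=1,\dots,n$. It is called externally positive if its impulse response, i.e. its inverse Laplace transform $h(t)=\mathfrak{L}^{-1}\{H(s)\}$, satisfies $h(t)\ge 0$ for all $t\in[0,+\infty)$ (equivalently, its step response is monotonically non-decreasing). For strictly proper $H$ ($n>m$), $h$ is the continuous function on $[0,\infty)$ with Laplace transform $H$. *)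

theory Defs
  imports
    "HOL-Analysis.Analysis"
    "HOL-Computational_Algebra.Polynomial"
    "HOL-Library.Multiset"
begin

definition cnj_closed :: "complex list \<Rightarrow> bool" where
  "cnj_closed xs \<longleftrightarrow> mset (map cnj xs) = mset xs"

text \<open>The transfer function with numerator \<open>B\<close> and list of poles \<open>ps\<close>. Poles are given as data,
  so that a pole cancelled by a root of \<open>B\<close> still counts for stability.\<close>

definition transfer_function :: "complex poly \<Rightarrow> complex list \<Rightarrow> complex \<Rightarrow> complex" where
  "transfer_function B ps s = poly B s / (\<Prod>p\<leftarrow>ps. s - p)"

definition stable_poles :: "complex list \<Rightarrow> bool" where
  "stable_poles ps \<longleftrightarrow> (\<forall>p\<in>set ps. Re p < 0)"

text \<open>\<open>H\<close> is the unilateral Laplace transform of \<open>h\<close>: the integral converges to \<open>H s\<close> on some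
  right half-plane.\<close>

definition has_laplace_transform :: "(real \<Rightarrow> real) \<Rightarrow> (complex \<Rightarrow> complex) \<Rightarrow> bool" where
  "has_laplace_transform h H \<longleftrightarrow>
     (\<exists>\<sigma>::real. \<forall>s. Re s > \<sigma> \<longrightarrow>
        ((\<lambda>t. exp (- (s * complex_of_real t)) * complex_of_real (h t)) has_integral H s) {0..})"

text \<open>For strictly proper \<open>H\<close> with real coefficients the impulse response is the continuous real
  function on \<open>[0,\<infinity>)\<close> with Laplace transform \<open>H\<close>. It is unique there; values at negative
  times are left unconstrained. This notion is not meant for functions \<open>H\<close> that are not strictly
  proper, whose impulse response is not a function.\<close>

definition impulse_response :: "(complex \<Rightarrow> complex) \<Rightarrow> (real \<Rightarrow> real) \<Rightarrow> bool" where
  "impulse_response H h \<longleftrightarrow> continuous_on {0..} h \<and> has_laplace_transform h H"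

definition externally_positive :: "(complex \<Rightarrow> complex) \<Rightarrow> bool" where
  "externally_positive H \<longleftrightarrow> (\<exists>h. impulse_response H h \<and> (\<forall>t\<ge>0. h t \<ge> 0))"

definition numerator_poly :: "real \<Rightarrow> complex list \<Rightarrow> complex poly" where
  "numerator_poly K zs = smult (complex_of_real K) (\<Prod>z\<leftarrow>zs. [:- z, 1:])"

text \<open>With \<open>B(s) = (\<Sum>i=0..n. b\<^sub>i s\<^sup>n\<^sup>-\<^sup>i)\<close>, the coefficient \<open>b\<^sub>i\<close> is \<open>coeff B (n - i)\<close>; it is
  divided by \<open>(i - 1)!\<close>. The summation starts at \<open>i = 1\<close>, so the subtractions do not truncate.\<close>

definition B_tilde :: "nat \<Rightarrow> complex poly \<Rightarrow> complex poly" where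
  "B_tilde n B = (\<Sum>i=1..n. monom (coeff B (n - i) / fact (i - 1)) (n - i))"

end

theory Submission
  imports Defs
begin

text \<open>Write \<open>D(s) = (\<Prod>i. s - p\<^sub>i)\<close>, and let \<open>h\<^sub>0(t) = t\<^sup>n\<^sup>-\<^sup>1 B\<^sub>~(1/t)\<close> be the impulse response of \<open>B(s) / s\<^sup>n\<close>,
  where \<open>B\<^sub>~\<close> is the polynomial of (b). If \<open>B / D\<close> is stable and has impulse response \<open>h \<ge> 0\<close>, then
  \<open>D\<close> has nonnegative coefficients, and \<open>B / s\<^sup>n = (B / D) \<cdot> (D / s\<^sup>n)\<close> exhibits \<open>h\<^sub>0\<close> as a nonnegative
  combination of iterated integrals of \<open>h\<close>. A zero \<open>t > 0\<close> of \<open>h\<^sub>0\<close> would force \<open>h\<close>, hence \<open>h\<^sub>0\<close>, to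
  vanish on \<open>[0, t]\<close>, so \<open>B\<^sub>~ = 0\<close>. Conversely, if \<open>B\<^sub>~ > 0\<close> on \<open>[0, \<infinity>)\<close>, this persists when \<open>B(s)\<close> is
  replaced by \<open>B(s - \<lambda>)\<close> with small \<open>\<lambda> > 0\<close>, and then all poles can be placed at \<open>-\<lambda>\<close>.\<close>

subsection \<open>Integrals and Laplace transforms on the half-line\<close>

text \<open>The integral over an unbounded set is tested on boxes containing a large ball. Such a
  box starts below 0, so after extension by zero only its right end matters, and the test becomes
  convergence of the improper integral.\<close>

lemma has_integral_Ici_iff:
  fixes f :: "real \<Rightarrow> 'a::banach"
  assumes f: "continuous_on {0..} f"
  shows "(f has_integral I) {0..} \<longleftrightarrow> ((\<lambda>T. integral {0..T} f) \<longlongrightarrow> I) at_top"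
proof -
  have fi: "f integrable_on {a..b}" if "0 \<le> a" for a b
    using that by (intro integrable_continuous_interval continuous_on_subset[OF f]) auto
  have restr: "(\<lambda>x. if x \<in> {0..} then f x else 0) integrable_on cbox a b" for a b
  proof -
    have "{0..} \<inter> {a..b} = {max a 0..b}" by auto
    then have "f integrable_on {0..} \<inter> {a..b}"
      using fi[of "max a 0" b] by (metis max.cobounded2)
    then show ?thesis
      by (simp only: integrable_restrict_Int cbox_interval)
  qed
  have int_eq: "integral (cbox a b) (\<lambda>x. if x \<in> {0..} then f x else 0) = integral {0..b} f" if "a \<le> 0" for a b
  proof -
    have "{0..} \<inter> {a..b} = {0..b}" using that by auto
    then show ?thesis
      by (simp only: integral_restrict_Int cbox_interval)
  qed
  show ?thesis
  proof
    assume "(f has_integral I) {0..}"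
    then have *: "\<exists>B>0. \<forall>a b. ball 0 B \<subseteq> cbox a b \<longrightarrow>
            norm (integral (cbox a b) (\<lambda>x. if x \<in> {0..} then f x else 0) - I) < e" if "e > 0" for e
      using that unfolding has_integral_alt'[of f] by blast
    show "((\<lambda>T. integral {0..T} f) \<longlongrightarrow> I) at_top"
    proof (rule tendstoI)
      fix e :: real assume "e > 0"
      then obtain B where B: "B > 0" "\<And>a b. ball 0 B \<subseteq> cbox a b \<Longrightarrow>
            norm (integral (cbox a b) (\<lambda>x. if x \<in> {0..} then f x else 0) - I) < e"
        using * by blast
      have "dist (integral {0..T} f) I < e" if "T \<ge> B" for T
      proof -
        have "ball 0 B \<subseteq> cbox (-B) T" using that by (auto simp: dist_real_def)
        from B(2)[OF this] int_eq[of "-B" T] B(1) show ?thesis by (simp add: dist_norm)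
      qed
      then show "\<forall>\<^sub>F T in at_top. dist (integral {0..T} f) I < e"
        unfolding eventually_at_top_linorder by blast
    qed
  next
    assume lim: "((\<lambda>T. integral {0..T} f) \<longlongrightarrow> I) at_top"
    show "(f has_integral I) {0..}"
      unfolding has_integral_alt'[of f]
    proof (intro conjI allI impI restr)
      fix e :: real assume "e > 0"
      from tendstoD[OF lim this] obtain N where N: "\<And>T. T \<ge> N \<Longrightarrow> dist (integral {0..T} f) I < e"
        unfolding eventually_at_top_linorder by blast
      show "\<exists>B>0. \<forall>a b. ball 0 B \<subseteq> cbox a b \<longrightarrow>
          norm (integral (cbox a b) (\<lambda>x. if x \<in> {0..} then f x else 0) - I) < e"
      \<comment> \<open>The open ball of this radius contains both 0 and \<open>max N 0\<close>, so
        a box around it has \<open>a \<le> 0\<close> and \<open>b \<ge> N\<close>.\<close>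
      proof (intro exI[of _ "max N 0 + 1"] conjI allI impI)
        fix a b :: real assume sub: "ball 0 (max N 0 + 1) \<subseteq> cbox a b"
        have "0 \<in> ball (0::real) (max N 0 + 1)" "max N 0 \<in> ball (0::real) (max N 0 + 1)" by auto
        with sub have "0 \<in> {a..b}" "max N 0 \<in> {a..b}" unfolding cbox_interval by blast+
        then have "a \<le> 0" "b \<ge> N" by auto
        with N[of b] int_eq[of a b] show "norm (integral (cbox a b) (\<lambda>x. if x \<in> {0..} then f x else 0) - I) < e"
          by (simp add: dist_norm)
      qed auto
    qed
  qed
qed

text \<open>The derivative is one-sided at 0, to cover antiderivatives built from
  \<open>primitive f\<close>, which are controlled only on the half-line.\<close>

lemma has_integral_Ici_FTC:
  fixes G :: "real \<Rightarrow> 'a::banach"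
  assumes g: "continuous_on {0..} g"
    and deriv: "\<And>t. t \<ge> 0 \<Longrightarrow> (G has_vector_derivative g t) (at t within {0..})"
    and lim: "(G \<longlongrightarrow> L) at_top"
  shows "(g has_integral (L - G 0)) {0..}"
  unfolding has_integral_Ici_iff[OF g]
proof -
  have "integral {0..T} g = G T - G 0" if "T \<ge> 0" for T
    by (intro integral_unique fundamental_theorem_of_calculus that)
      (auto intro: has_vector_derivative_within_subset[OF deriv])
  then have "\<forall>\<^sub>F T in at_top. G T - G 0 = integral {0..T} g"
    unfolding eventually_at_top_linorder by (intro exI[of _ 0]) auto
  then show "((\<lambda>T. integral {0..T} g) \<longlongrightarrow> L - G 0) at_top"
    by (rule Lim_transform_eventually[rotated]) (intro tendsto_intros lim)
qed

lemma power_exp_decay: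
  fixes r :: real
  assumes "r > 0"
  shows "((\<lambda>t. exp (- (r * t)) * t ^ n) \<longlongrightarrow> 0) at_top"
proof -
  have "((\<lambda>t. (r * t) ^ n / exp (r * t)) \<longlongrightarrow> 0) at_top"
    by (rule filterlim_compose[OF tendsto_power_div_exp_0])
      (rule filterlim_tendsto_pos_mult_at_top[OF tendsto_const assms filterlim_ident])
  from tendsto_mult_left[OF this, of "1 / r ^ n"] show ?thesis
    using assms by (simp add: power_mult_distrib exp_minus field_simps)
qed

text \<open>Integration by parts: in the induction step the antiderivative \<open>?G\<close>
  vanishes at 0 and at infinity, so raising \<open>k\<close> by one divides the transform by
  \<open>w\<close>. Complex \<open>w\<close> is needed because \<open>has_laplace_transform\<close>
  speaks of a complex half-plane.\<close>

lemma monomial_exp_has_integral: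
  assumes w: "Re w > 0"
  shows "((\<lambda>t. exp (- (w * complex_of_real t)) * (complex_of_real t ^ k / fact k)) has_integral 1 / w ^ Suc k) {0..}"
proof (induction k)
  case 0
  let ?G = "\<lambda>t. - exp (- (w * complex_of_real t)) / w"
  have "(?G \<longlongrightarrow> 0) at_top"
  proof (rule tendsto_norm_zero_cancel)
    have "((\<lambda>t. exp (- (Re w * t)) / norm w) \<longlongrightarrow> 0) at_top"
      using tendsto_divide_zero[OF power_exp_decay[OF w, of 0]] by simp
    then show "((\<lambda>t. norm (?G t)) \<longlongrightarrow> 0) at_top"
      by (simp add: norm_divide)
  qed
  moreover have "(?G has_vector_derivative exp (- (w * complex_of_real t))) (at t within {0..})" for t
  proof -
    have "((\<lambda>z. - exp (- (w * z)) / w) has_field_derivative exp (- (w * z))) (at z)" for z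
      by (rule derivative_eq_intros refl)+ (use w in auto)
    then show ?thesis by (rule has_vector_derivative_real_field)
  qed
  ultimately have "((\<lambda>t. exp (- (w * complex_of_real t))) has_integral (0 - ?G 0)) {0..}"
    by (intro has_integral_Ici_FTC continuous_intros)
  then show ?case by simp
next
  case (Suc k)
  let ?e = "\<lambda>t. exp (- (w * complex_of_real t))"
  let ?G = "\<lambda>t. - ?e t * (complex_of_real t ^ Suc k / fact (Suc k)) / w"
  let ?g = "\<lambda>t. ?e t * (complex_of_real t ^ Suc k / fact (Suc k)) - ?e t * (complex_of_real t ^ k / fact k) / w"
  have w0: "w \<noteq> 0" using w by auto
  have lim: "(?G \<longlongrightarrow> 0) at_top"
  proof (rule tendsto_norm_zero_cancel)
    have "((\<lambda>t. exp (- (Re w * t)) * (\<bar>t\<bar> ^ Suc k / fact (Suc k)) / norm w) \<longlongrightarrow> 0) at_top"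
      using tendsto_divide_zero[OF tendsto_norm_zero[OF power_exp_decay[OF w, of "Suc k"]], of "fact (Suc k) * norm w"]
      by (simp add: abs_mult power_abs del: power_Suc fact_Suc)
    then show "((\<lambda>t. norm (?G t)) \<longlongrightarrow> 0) at_top"
      by (simp add: norm_divide norm_mult norm_power del: power_Suc fact_Suc)
  qed
  have deriv: "(?G has_vector_derivative ?g t) (at t within {0..})" for t
  proof -
    have "((\<lambda>z. - exp (- (w * z)) * (z ^ Suc k / fact (Suc k)) / w) has_field_derivative
        exp (- (w * z)) * (z ^ Suc k / fact (Suc k)) - exp (- (w * z)) * (z ^ k / fact k) / w) (at z)" for z
    proof -
      have "((\<lambda>z. exp (- (w * z)) * z ^ Suc k) has_field_derivative
          of_nat (Suc k) * z ^ k * exp (- (w * z)) - w * exp (- (w * z)) * z ^ Suc k) (at z)"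
        by (rule derivative_eq_intros refl)+ (simp add: algebra_simps)
      note D = DERIV_cmult[OF this, of "- 1 / (of_nat (Suc k) * fact k * w)"]
      have "(\<lambda>z. - exp (- (w * z)) * (z ^ Suc k / fact (Suc k)) / w) =
          (\<lambda>z. - 1 / (of_nat (Suc k) * fact k * w) * (exp (- (w * z)) * z ^ Suc k))"
        by (simp add: fun_eq_iff del: of_nat_Suc power_Suc)
      moreover have "exp (- (w * z)) * (z ^ Suc k / fact (Suc k)) - exp (- (w * z)) * (z ^ k / fact k) / w =
          - 1 / (of_nat (Suc k) * fact k * w) *
          (of_nat (Suc k) * z ^ k * exp (- (w * z)) - w * exp (- (w * z)) * z ^ Suc k)"
        using w0 by (simp add: field_simps del: of_nat_Suc power_Suc)
      ultimately show ?thesis using D by (simp only:)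
    qed
    then show ?thesis by (rule has_vector_derivative_real_field)
  qed
  have "(?g has_integral (0 - ?G 0)) {0..}"
    by (rule has_integral_Ici_FTC[OF _ deriv lim]) (intro continuous_intros, use w0 in \<open>simp_all del: fact_Suc\<close>)
  from has_integral_add[OF this has_integral_divide[OF Suc, of w]]
  show ?case using w0 by (simp add: ac_simps)
qed

section \<open>Transforms at real arguments and exponential order\<close>

text \<open>Large real arguments suffice for the uniqueness statement \<open>lerch\<close>; the
  values \<open>F s\<close> at smaller \<open>s\<close> stay free.\<close>

definition real_laplace :: "(real \<Rightarrow> real) \<Rightarrow> (real \<Rightarrow> real) \<Rightarrow> bool" where
  "real_laplace f F \<longleftrightarrow> (\<exists>\<sigma>. \<forall>s>\<sigma>. ((\<lambda>t. exp (- (s * t)) * f t) has_integral F s) {0..})"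

definition exp_order :: "(real \<Rightarrow> real) \<Rightarrow> bool" where
  "exp_order f \<longleftrightarrow> (\<exists>C \<sigma>. \<forall>t\<ge>0. \<bar>f t\<bar> \<le> C * exp (\<sigma> * t))"

text \<open>An operator on functions, so that \<open>primitive ^^ k\<close> is k-fold integration
  from 0.\<close>

definition primitive :: "(real \<Rightarrow> real) \<Rightarrow> real \<Rightarrow> real" where
  "primitive f t = integral {0..t} f"

lemma real_laplace_monomial: "real_laplace (\<lambda>t. t ^ k / fact k) (\<lambda>s. 1 / s ^ Suc k)"
  unfolding real_laplace_def
proof (intro exI[of _ 0] allI impI)
  fix s :: real assume "s > 0"
  then have "((\<lambda>t. exp (- (complex_of_real s * complex_of_real t)) * (complex_of_real t ^ k / fact k))
      has_integral 1 / complex_of_real s ^ Suc k) {0..}"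
    by (intro monomial_exp_has_integral) simp
  from has_integral_Re[OF this]
  have "((\<lambda>t. Re (complex_of_real (exp (- (s * t)) * (t ^ k / fact k)))) has_integral
      Re (complex_of_real (1 / s ^ Suc k))) {0..}"
    by (simp only: exp_of_real[symmetric] of_real_mult of_real_minus of_real_divide of_real_power of_real_fact of_real_1)
  then show "((\<lambda>t. exp (- (s * t)) * (t ^ k / fact k)) has_integral 1 / s ^ Suc k) {0..}"
    by (simp only: Re_complex_of_real)
qed

lemma real_laplace_add:
  assumes "real_laplace f F" "real_laplace g G"
  shows "real_laplace (\<lambda>t. f t + g t) (\<lambda>s. F s + G s)"
proof -
  obtain a b where a: "\<And>s. s > a \<Longrightarrow> ((\<lambda>t. exp (- (s * t)) * f t) has_integral F s) {0..}"
    and b: "\<And>s. s > b \<Longrightarrow> ((\<lambda>t. exp (- (s * t)) * g t) has_integral G s) {0..}"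
    using assms unfolding real_laplace_def by blast
  show ?thesis unfolding real_laplace_def
    by (intro exI[of _ "max a b"] allI impI)
      (use has_integral_add[OF a b] in \<open>auto simp: algebra_simps\<close>)
qed

lemma real_laplace_cmult:
  assumes "real_laplace f F"
  shows "real_laplace (\<lambda>t. c * f t) (\<lambda>s. c * F s)"
proof -
  obtain a where a: "\<And>s. s > a \<Longrightarrow> ((\<lambda>t. exp (- (s * t)) * f t) has_integral F s) {0..}"
    using assms unfolding real_laplace_def by blast
  show ?thesis unfolding real_laplace_def
    by (intro exI[of _ a] allI impI)
      (use has_integral_mult_right[OF a, of _ c] in \<open>auto simp: algebra_simps\<close>)
qed

lemma real_laplace_sum:
  assumes "finite A" "\<And>i. i \<in> A \<Longrightarrow> real_laplace (f i) (F i)"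
  shows "real_laplace (\<lambda>t. \<Sum>i\<in>A. f i t) (\<lambda>s. \<Sum>i\<in>A. F i s)"
  using assms
proof (induction A)
  case empty
  show ?case by (auto simp: real_laplace_def)
next
  case (insert x A)
  then show ?case by (auto intro!: real_laplace_add)
qed

lemma exp_order_bound:
  assumes "exp_order f"
  obtains C \<sigma> where "C \<ge> 0" "\<sigma> \<ge> b" "\<And>t. t \<ge> 0 \<Longrightarrow> \<bar>f t\<bar> \<le> C * exp (\<sigma> * t)"
proof -
  obtain C \<tau> where C: "\<And>t. t \<ge> 0 \<Longrightarrow> \<bar>f t\<bar> \<le> C * exp (\<tau> * t)"
    using assms unfolding exp_order_def by blast
  from C[of 0] have C0: "C \<ge> 0" by simp
  have "\<bar>f t\<bar> \<le> C * exp (max b \<tau> * t)" if "t \<ge> 0" for t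
    by (rule order_trans[OF C[OF that]]) (intro mult_left_mono C0, simp add: that mult_right_mono)
  then show ?thesis using that[of C "max b \<tau>"] C0 by simp
qed

lemma exp_order_add:
  assumes "exp_order f" "exp_order g"
  shows "exp_order (\<lambda>t. f t + g t)"
proof -
  obtain C a where f: "\<And>t. t \<ge> 0 \<Longrightarrow> \<bar>f t\<bar> \<le> C * exp (a * t)"
    using assms(1) unfolding exp_order_def by blast
  obtain D b where D: "D \<ge> 0" "b \<ge> a" and g: "\<And>t. t \<ge> 0 \<Longrightarrow> \<bar>g t\<bar> \<le> D * exp (b * t)"
    using exp_order_bound[OF assms(2)] by blast
  from f[of 0] have C: "C \<ge> 0" by simp
  have "\<bar>f t + g t\<bar> \<le> (C + D) * exp (b * t)" if "t \<ge> 0" for t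
  proof -
    have "C * exp (a * t) \<le> C * exp (b * t)"
      using that D(2) by (intro mult_left_mono C) (simp add: mult_right_mono)
    with f[OF that] g[OF that] show ?thesis by (simp add: algebra_simps)
  qed
  then show ?thesis unfolding exp_order_def by blast
qed

lemma exp_order_cmult:
  assumes "exp_order f"
  shows "exp_order (\<lambda>t. c * f t)"
proof -
  obtain C a where f: "\<And>t. t \<ge> 0 \<Longrightarrow> \<bar>f t\<bar> \<le> C * exp (a * t)"
    using assms(1) unfolding exp_order_def by blast
  have "\<bar>c * f t\<bar> \<le> \<bar>c\<bar> * C * exp (a * t)" if "t \<ge> 0" for t
    using mult_left_mono[OF f[OF that], of "\<bar>c\<bar>"] by (simp add: abs_mult mult.assoc)
  then show ?thesis unfolding exp_order_def by blast
qed

lemma exp_order_sum: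
  assumes "finite A" "\<And>i. i \<in> A \<Longrightarrow> exp_order (f i)"
  shows "exp_order (\<lambda>t. \<Sum>i\<in>A. f i t)"
  using assms
proof (induction A)
  case empty
  show ?case by (auto simp: exp_order_def intro: exI[of _ 0])
next
  case (insert x A)
  then show ?case by (auto intro!: exp_order_add)
qed

lemma exp_order_power: "exp_order (\<lambda>t. t ^ k)"
  unfolding exp_order_def
proof (intro exI allI impI)
  fix t :: real assume "t \<ge> 0"
  have "t ^ k \<le> exp t ^ k"
    using \<open>t \<ge> 0\<close> exp_ge_add_one_self[of t] by (intro power_mono) linarith+
  then show "\<bar>t ^ k\<bar> \<le> 1 * exp (real k * t)"
    using \<open>t \<ge> 0\<close> by (simp add: exp_of_nat_mult)
qed

section \<open>Transforms of primitives\<close>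

lemma primitive_has_derivative:
  assumes "continuous_on {0..} f" "t \<ge> 0"
  shows "(primitive f has_real_derivative f t) (at t within {0..})"
proof -
  have "(primitive f has_real_derivative f t) (at t within {0..t+1})"
    unfolding primitive_def using assms
    by (intro integral_has_real_derivative continuous_on_subset[OF assms(1)]) auto
  moreover have "at t within {0..t+1} = at t within {0..}"
    by (rule at_within_nhd[of _ "{..<t+1}"]) auto
  ultimately show ?thesis by simp
qed

lemma continuous_on_primitive:
  "continuous_on {0..} f \<Longrightarrow> continuous_on {0..} (primitive f)"
  by (meson DERIV_continuous_on atLeast_iff primitive_has_derivative)

lemma primitive_nonneg:
  assumes "continuous_on {0..} f" "\<And>t. t \<ge> 0 \<Longrightarrow> f t \<ge> 0"
  shows "primitive f t \<ge> 0"
  unfolding primitive_def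
  by (intro integral_nonneg integrable_continuous_interval continuous_on_subset[OF assms(1)]) (auto simp: assms)

lemma exp_order_primitive:
  assumes f: "continuous_on {0..} f" and "exp_order f"
  shows "exp_order (primitive f)"
proof -
  obtain C \<sigma> where C: "C \<ge> 0" "\<sigma> \<ge> 0" "\<And>t. t \<ge> 0 \<Longrightarrow> \<bar>f t\<bar> \<le> C * exp (\<sigma> * t)"
    using exp_order_bound[OF assms(2)] by blast
  \<comment> \<open>The rate rises by one to absorb the interval length \<open>t\<close> through
    \<open>t \<le> exp t\<close>.\<close>
  have "\<bar>primitive f t\<bar> \<le> C * exp ((\<sigma> + 1) * t)" if t: "t \<ge> 0" for t
  proof -
    have "norm (f x) \<le> C * exp (\<sigma> * t)" if "x \<in> {0..t}" for x
    proof -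
      have "C * exp (\<sigma> * x) \<le> C * exp (\<sigma> * t)"
        using that C by (intro mult_left_mono) (auto simp: mult_left_mono)
      with C(3)[of x] that show ?thesis by simp
    qed
    then have "\<bar>primitive f t\<bar> \<le> C * exp (\<sigma> * t) * (t - 0)"
      unfolding primitive_def real_norm_def[symmetric]
      by (intro integral_bound t continuous_on_subset[OF f]) auto
    also have "\<dots> \<le> C * exp (\<sigma> * t) * exp t"
    proof -
      have "t - 0 \<le> exp t" using exp_ge_add_one_self[of t] by linarith
      then show ?thesis using C(1) by (intro mult_left_mono) auto
    qed
    finally show ?thesis by (simp add: algebra_simps exp_add)
  qed
  then show ?thesis unfolding exp_order_def by blast
qed

text \<open>Convergence of the transform does not bound \<open>f\<close> pointwise, but for
  nonnegative \<open>f\<close> it bounds the integral: on \<open>[0, t]\<close> the weight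
  \<open>exp (s * (t - x))\<close> is at least 1, whence
  \<open>primitive f t \<le> exp (s * t) * F s\<close>. This supplies a growth bound for an impulse
  response known only through its transform.\<close>

lemma exp_order_primitive_nonneg:
  assumes f: "continuous_on {0..} f" "\<And>t. t \<ge> 0 \<Longrightarrow> f t \<ge> 0" and "real_laplace f F"
  shows "exp_order (primitive f)"
proof -
  obtain \<sigma> where \<sigma>: "\<And>s. s > \<sigma> \<Longrightarrow> ((\<lambda>t. exp (- (s * t)) * f t) has_integral F s) {0..}"
    using assms(3) unfolding real_laplace_def by blast
  define s where "s = max \<sigma> 0 + 1"
  have s: "s > \<sigma>" "s \<ge> 0" by (auto simp: s_def)
  have cont: "continuous_on {0..} (\<lambda>t. exp (- (s * t)) * f t)"
    by (intro continuous_intros f)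
  have "\<bar>primitive f t\<bar> \<le> F s * exp (s * t)" if t: "t \<ge> 0" for t
  proof -
    have i1: "(\<lambda>x. exp (- (s * x)) * f x) integrable_on {0..t}"
      by (intro integrable_continuous_interval continuous_on_subset[OF cont]) auto
    have "primitive f t \<le> integral {0..t} (\<lambda>x. exp (s * t) * (exp (- (s * x)) * f x))"
      unfolding primitive_def
    proof (intro integral_le integrable_on_mult_right i1)
      show "f integrable_on {0..t}"
        by (intro integrable_continuous_interval continuous_on_subset[OF f(1)]) auto
      fix x assume x: "x \<in> {0..t}"
      have "1 * f x \<le> exp (s * (t - x)) * f x"
        using x s f by (intro mult_right_mono) auto
      also have "exp (s * (t - x)) = exp (s * t) * exp (- (s * x))"
        by (simp add: algebra_simps exp_diff exp_minus divide_simps)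
      finally show "f x \<le> exp (s * t) * (exp (- (s * x)) * f x)" by (simp add: mult.assoc)
    qed
    also have "\<dots> = exp (s * t) * integral {0..t} (\<lambda>x. exp (- (s * x)) * f x)" by simp
    also have "integral {0..t} (\<lambda>x. exp (- (s * x)) * f x) \<le> F s"
    proof -
      have "integral {0..t} (\<lambda>x. exp (- (s * x)) * f x) \<le> integral {0..} (\<lambda>x. exp (- (s * x)) * f x)"
        using \<sigma>[OF s(1)] i1 f(2) by (intro integral_subset_le) (auto intro: has_integral_integrable)
      with \<sigma>[OF s(1)] show ?thesis by (simp add: integral_unique)
    qed
    finally show ?thesis using primitive_nonneg[OF f, of t] by (simp add: mult.commute)
  qed
  then show ?thesis unfolding exp_order_def by blast
qed

text \<open>Integration by parts with \<open>exp (- (s * t)) * primitive f t\<close>, which is 0 at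
  0 and, by the exponential bound, tends to 0 once \<open>s\<close> exceeds the growth rate.\<close>

lemma real_laplace_primitive:
  assumes f: "continuous_on {0..} f" and "exp_order (primitive f)" and "real_laplace f F"
  shows "real_laplace (primitive f) (\<lambda>s. F s / s)"
proof -
  obtain \<sigma> where \<sigma>: "\<And>s. s > \<sigma> \<Longrightarrow> ((\<lambda>t. exp (- (s * t)) * f t) has_integral F s) {0..}"
    using assms(3) unfolding real_laplace_def by blast
  obtain C \<tau> where C: "\<tau> \<ge> 0" "\<And>t. t \<ge> 0 \<Longrightarrow> \<bar>primitive f t\<bar> \<le> C * exp (\<tau> * t)"
    using exp_order_bound[OF assms(2)] by blast
  show ?thesis unfolding real_laplace_def
  proof (intro exI[of _ "max \<sigma> \<tau>"] allI impI)
    fix s assume "max \<sigma> \<tau> < s"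
    then have s: "s > \<sigma>" "s > \<tau>" "s > 0" using C(1) by auto
    let ?G = "\<lambda>t. exp (- (s * t)) * primitive f t"
    let ?g = "\<lambda>t. exp (- (s * t)) * f t - s * (exp (- (s * t)) * primitive f t)"
    have lim: "(?G \<longlongrightarrow> 0) at_top"
    proof (rule Lim_null_comparison)
      have "norm (?G t) \<le> C * exp (- ((s - \<tau>) * t))" if "t \<ge> 0" for t
      proof -
        have "norm (?G t) \<le> exp (- (s * t)) * (C * exp (\<tau> * t))"
          using C(2)[OF that] by (simp add: abs_mult mult_left_mono)
        also have "\<dots> = C * exp (- ((s - \<tau>) * t))" by (simp add: algebra_simps exp_diff exp_minus divide_simps)
        finally show ?thesis .
      qed
      then show "\<forall>\<^sub>F t in at_top. norm (?G t) \<le> C * exp (- ((s - \<tau>) * t))"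
        unfolding eventually_at_top_linorder by blast
      show "((\<lambda>t. C * exp (- ((s - \<tau>) * t))) \<longlongrightarrow> 0) at_top"
        using tendsto_mult_right_zero[OF power_exp_decay[of "s - \<tau>" 0], of C] s by simp
    qed
    have "(?g has_integral (0 - ?G 0)) {0..}"
    proof (rule has_integral_Ici_FTC[OF _ _ lim])
      show "continuous_on {0..} ?g"
        by (intro continuous_intros f continuous_on_primitive)
      fix t :: real assume "t \<ge> 0"
      then show "(?G has_vector_derivative ?g t) (at t within {0..})"
        unfolding has_real_derivative_iff_has_vector_derivative[symmetric]
        by (auto intro!: derivative_eq_intros primitive_has_derivative f simp: algebra_simps)
    qed
    then have "(?g has_integral 0) {0..}" by (simp add: primitive_def)
    from has_integral_diff[OF \<sigma>[OF s(1)] this]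
    have "((\<lambda>t. s * (exp (- (s * t)) * primitive f t)) has_integral F s) {0..}" by simp
    from has_integral_divide[OF this, of s] s(3)
    show "((\<lambda>t. exp (- (s * t)) * primitive f t) has_integral F s / s) {0..}" by simp
  qed
qed

text \<open>With \<open>u = e\<^sup>-\<^sup>t\<close>, all moments of
  \<open>\<phi> u = u\<^sup>c f (- ln u)\<close> vanish, so \<open>\<phi>\<close> is orthogonal to its own polynomial approximations.\<close>

lemma lerch:
  assumes f: "continuous_on {0..} f" and "exp_order f" and "real_laplace f (\<lambda>s. 0)" and t: "t \<ge> 0"
  shows "f t = 0"
proof -
  obtain \<sigma> where \<sigma>: "\<And>s. s > \<sigma> \<Longrightarrow> ((\<lambda>t. exp (- (s * t)) * f t) has_integral 0) {0..}"
    using assms(3) unfolding real_laplace_def by blast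
  obtain C \<tau> where C: "C \<ge> 0" "\<tau> \<ge> \<sigma>" "\<And>t. t \<ge> 0 \<Longrightarrow> \<bar>f t\<bar> \<le> C * exp (\<tau> * t)"
    using exp_order_bound[OF assms(2)] by blast
  \<comment> \<open>One more than the growth rate: then
    \<open>\<bar>\<phi> u\<bar> \<le> C * u\<close>, which makes \<open>\<phi>\<close> continuous at
    0. The arguments \<open>c + k + 1\<close> of the transform also lie beyond
    \<open>\<sigma>\<close>.\<close>
  define c where "c = \<tau> + 1"
  define \<phi> where "\<phi> u = (if u \<le> 0 then 0 else exp (c * ln u) * f (- ln u))" for u
  have \<phi>_exp: "\<phi> (exp (- x)) = exp (- (c * x)) * f x" for x
    by (simp add: \<phi>_def)
  have \<phi>_le: "\<bar>\<phi> u\<bar> \<le> C * u" if "u \<in> {0..1}" for u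
  proof (cases "u = 0")
    case False
    with that have u: "u > 0" "u \<le> 1" by auto
    have "\<bar>\<phi> u\<bar> \<le> exp (c * ln u) * (C * exp (\<tau> * - ln u))"
      using u C(3)[of "- ln u"] by (auto simp: \<phi>_def abs_mult intro!: mult_left_mono)
    also have "\<dots> = C * exp (ln u)" by (simp add: c_def algebra_simps exp_add exp_minus)
    finally show ?thesis using u by simp
  qed (simp add: \<phi>_def)
  have \<phi>_cont: "continuous_on {0..1} \<phi>"
    unfolding continuous_on_eq_continuous_within
  proof
    fix u :: real assume u: "u \<in> {0..1}"
    show "continuous (at u within {0..1}) \<phi>"
    proof (cases "u = 0")
      case True
      have "(\<phi> \<longlongrightarrow> 0) (at 0 within {0..1})"
      proof (rule Lim_null_comparison)
        show "\<forall>\<^sub>F x in at 0 within {0..1}. norm (\<phi> x) \<le> C * x"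
          using \<phi>_le by (auto simp: eventually_at_filter)
        have "((\<lambda>x. C * x) \<longlongrightarrow> C * 0) (at 0 within {0..1})" by (intro tendsto_intros)
        then show "((\<lambda>x. C * x) \<longlongrightarrow> 0) (at 0 within {0..1})" by simp
      qed
      then show ?thesis using True by (simp add: continuous_within \<phi>_def)
    next
      case False
      with u have u: "u > 0" "u \<le> 1" by auto
      have "continuous_on {0<..1} (\<lambda>u. exp (c * ln u) * f (- ln u))"
        by (intro continuous_intros continuous_on_compose2[OF f]) auto
      then have "continuous_on {0<..1} \<phi>"
        by (subst continuous_on_cong[OF refl, where g = "\<lambda>u. exp (c * ln u) * f (- ln u)"]) (auto simp: \<phi>_def)
      then have "continuous (at u within {0<..1}) \<phi>"
        using u by (simp add: continuous_on_eq_continuous_within)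
      moreover have "at u within {0..1} = at u within {0<..1}"
        using u by (intro at_within_nhd[of _ "{0<..}"]) auto
      ultimately show ?thesis by simp
    qed
  qed
  have \<phi>_C: "\<bar>\<phi> u\<bar> \<le> C" if "u \<in> {0..1}" for u
    using \<phi>_le[OF that] mult_left_mono[of u 1 C] C(1) that by auto
  \<comment> \<open>The k-th moment of \<open>\<phi>\<close> over \<open>[0, 1]\<close>, left in the
    variable \<open>x\<close> with \<open>u = exp (- x)\<close>; the leading factor
    \<open>exp (- x)\<close> is the Jacobian.\<close>
  have moment: "((\<lambda>x. exp (- x) * (exp (- x) ^ k * \<phi> (exp (- x)))) has_integral 0) {0..}" for k :: nat
  proof -
    have "exp (- x) * (exp (- x) ^ k * \<phi> (exp (- x))) = exp (- ((c + k + 1) * x)) * f x" for x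
      by (simp add: \<phi>_exp exp_of_nat_mult[symmetric] exp_add[symmetric] algebra_simps flip: mult.assoc)
    then show ?thesis using \<sigma>[of "c + k + 1"] C(2) by (simp add: c_def)
  qed
  have \<phi>e_cont: "continuous_on {0..} (\<lambda>x. \<phi> (exp (- x)))"
    by (intro continuous_on_compose2[OF \<phi>_cont] continuous_intros) auto
  \<comment> \<open>For \<open>T \<ge> 0\<close> this is the integral of
    \<open>\<phi>\<^sup>2\<close> over \<open>[exp (- T), 1]\<close>, in the same variable.\<close>
  define A where "A T = integral {0..T} (\<lambda>x. exp (- x) * (\<phi> (exp (- x)))\<^sup>2)" for T
  have A_int: "(\<lambda>x. exp (- x) * (\<phi> (exp (- x)))\<^sup>2) integrable_on {0..T}" for T
    by (intro integrable_continuous_interval continuous_intros continuous_on_subset[OF \<phi>e_cont]) auto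
  \<comment> \<open>For a polynomial \<open>p\<close> within \<open>e\<close> of
    \<open>\<phi>\<close>, pointwise \<open>\<phi>\<^sup>2 \<le> p * \<phi> + e * C\<close>; the
    product \<open>p * \<phi>\<close> integrates to 0 by the moments, and \<open>exp (- x)\<close>
    has mass at most 1.\<close>
  have A_le: "A T \<le> e * C" if e: "e > 0" for T e
  proof -
    obtain p where p: "real_polynomial_function p" "\<And>x. x \<in> {0..1} \<Longrightarrow> \<bar>\<phi> x - p x\<bar> < e"
      using Stone_Weierstrass_real_polynomial_function[OF _ \<phi>_cont e] by auto
    then obtain a N where p_eq: "p = (\<lambda>x. \<Sum>i\<le>N. a i * x ^ i)"
      unfolding real_polynomial_function_iff_sum by blast
    define g where "g x = exp (- x) * (p (exp (- x)) * \<phi> (exp (- x)))" for x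
    have g_int: "(g has_integral 0) {0..}"
    proof -
      have "g = (\<lambda>x. \<Sum>i\<le>N. a i * (exp (- x) * (exp (- x) ^ i * \<phi> (exp (- x)))))"
        by (simp add: fun_eq_iff g_def p_eq sum_distrib_left sum_distrib_right ac_simps)
      moreover have "(\<dots> has_integral (\<Sum>i\<le>N. a i * 0)) {0..}"
        by (intro has_integral_sum has_integral_mult_right moment) auto
      ultimately show ?thesis by simp
    qed
    have g_cont: "continuous_on {0..} g"
      unfolding g_def p_eq by (intro continuous_intros \<phi>e_cont)
    have lim: "((\<lambda>S. integral {0..S} g) \<longlongrightarrow> 0) at_top"
      using g_int has_integral_Ici_iff[OF g_cont] by blast
    \<comment> \<open>The integral of \<open>g\<close> vanishes only in the limit, so
      \<open>T\<close> is first enlarged to \<open>S\<close>, which the nonnegative integrand of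
      \<open>A\<close> permits.\<close>
    have "A T \<le> integral {0..S} g + e * C" if S: "S \<ge> max T 0" for S
    proof -
      have gi: "g integrable_on {0..S}"
        by (intro integrable_continuous_interval continuous_on_subset[OF g_cont]) auto
      have ee: "((\<lambda>x. exp (- x)) has_integral (- exp (- S) - - exp (- 0))) {0..S}"
        using S by (intro fundamental_theorem_of_calculus)
          (auto intro!: derivative_eq_intros simp flip: has_real_derivative_iff_has_vector_derivative)
      have "A T \<le> A S"
        unfolding A_def using S by (intro integral_subset_le A_int) auto
      also have "A S \<le> integral {0..S} (\<lambda>x. g x + e * C * exp (- x))"
        unfolding A_def
      proof (intro integral_le A_int integrable_add gi integrable_on_mult_right)
        show "(\<lambda>x. exp (- x)) integrable_on {0..S}" using ee by blast
        fix x assume "x \<in> {0..S}"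
        then have x: "exp (- x) \<in> {0..1}" by auto
        have "\<bar>\<phi> (exp (- x)) - p (exp (- x))\<bar> * \<bar>\<phi> (exp (- x))\<bar> \<le> e * C"
          using p(2)[OF x] \<phi>_C[OF x] e by (intro mult_mono) auto
        then have "(\<phi> (exp (- x)) - p (exp (- x))) * \<phi> (exp (- x)) \<le> e * C"
          unfolding abs_mult[symmetric] by simp
        then have "(\<phi> (exp (- x)))\<^sup>2 \<le> p (exp (- x)) * \<phi> (exp (- x)) + e * C"
          by (simp add: power2_eq_square algebra_simps)
        from mult_left_mono[OF this, of "exp (- x)"]
        show "exp (- x) * (\<phi> (exp (- x)))\<^sup>2 \<le> g x + e * C * exp (- x)"
          by (simp add: g_def algebra_simps)
      qed
      also have "\<dots> = integral {0..S} g + e * C * (1 - exp (- S))"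
        using has_integral_add[OF integrable_integral[OF gi] has_integral_mult_right[OF ee, of "e * C"]]
        by (intro integral_unique) simp
      also have "\<dots> \<le> integral {0..S} g + e * C * 1"
        using e C(1) by (intro add_left_mono mult_left_mono) auto
      finally show ?thesis by simp
    qed
    then have "\<forall>\<^sub>F S in at_top. A T \<le> integral {0..S} g + e * C"
      unfolding eventually_at_top_linorder by blast
    moreover have "((\<lambda>S. integral {0..S} g + e * C) \<longlongrightarrow> 0 + e * C) at_top"
      by (intro tendsto_intros lim)
    ultimately show ?thesis using tendsto_lowerbound[of _ _ at_top "A T"] by fastforce
  qed
  \<comment> \<open>The endpoint \<open>t + 1\<close> keeps the interval nondegenerate at
    \<open>t = 0\<close>.\<close>
  have "A (t + 1) \<le> 0"
  proof (rule field_le_epsilon)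
    fix e :: real assume "e > 0"
    \<comment> \<open>Dividing by \<open>C + 1\<close> instead of \<open>C\<close> covers
      \<open>C = 0\<close>.\<close>
    then have "A (t + 1) \<le> e / (C + 1) * C" using C(1) by (intro A_le) auto
    also have "\<dots> \<le> e" using C(1) \<open>e > 0\<close> by (simp add: field_simps)
    finally show "A (t + 1) \<le> 0 + e" by simp
  qed
  moreover have "A (t + 1) \<ge> 0"
    unfolding A_def by (intro integral_nonneg A_int) auto
  ultimately have "integral {0..t+1} (\<lambda>x. exp (- x) * (\<phi> (exp (- x)))\<^sup>2) = 0"
    by (simp add: A_def)
  moreover have "continuous_on {0..t+1} (\<lambda>x. exp (- x) * (\<phi> (exp (- x)))\<^sup>2)"
    by (intro continuous_intros continuous_on_subset[OF \<phi>e_cont]) auto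
  ultimately have "\<forall>x\<in>{0..t+1}. exp (- x) * (\<phi> (exp (- x)))\<^sup>2 = 0"
    using integral_eq_0_iff[of 0 "t + 1" "\<lambda>x. exp (- x) * (\<phi> (exp (- x)))\<^sup>2"] t by auto
  with t show ?thesis by (simp add: \<phi>_exp)
qed

subsection \<open>Real polynomials from conjugation-closed roots\<close>

abbreviation real_to_cpoly :: "real poly \<Rightarrow> complex poly" where
  "real_to_cpoly \<equiv> map_poly complex_of_real"

lemma real_to_cpoly_mult: "real_to_cpoly (p * q) = real_to_cpoly p * real_to_cpoly q"
  by (rule poly_eqI) (simp add: coeff_map_poly coeff_mult)

lemma poly_real_to_cpoly: "poly (real_to_cpoly p) (complex_of_real x) = complex_of_real (poly p x)"
  by (induction p) (auto simp: map_poly_pCons)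

text \<open>A real root is split off alone, any other root together with its conjugate, hence the
  induction on size. The resulting linear and quadratic factors have nonnegative coefficients when
  the roots lie in the open left half-plane, and products keep this.\<close>

lemma cnj_multiset_real_poly:
  assumes "image_mset cnj M = M"
  shows "\<exists>p :: real poly. real_to_cpoly p = (\<Prod>z\<in>#M. [:- z, 1:]) \<and> degree p = size M \<and> lead_coeff p = 1 \<and>
    ((\<forall>z\<in>#M. Re z < 0) \<longrightarrow> (\<forall>i. coeff p i \<ge> 0))"
  using assms
proof (induction "size M" arbitrary: M rule: less_induct)
  case less
  have mult: "coeff (p * q) i \<ge> 0" if "\<And>i. coeff p i \<ge> 0" "\<And>i. coeff q i \<ge> 0" for p q :: "real poly" and i
    unfolding coeff_mult by (intro sum_nonneg mult_nonneg_nonneg that)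
  show ?case
  proof (cases "M = {#}")
    case True
    show ?thesis
      by (rule exI[of _ 1]) (auto simp: True coeff_1 map_poly_1)
  next
    case False
    then obtain z M' where M: "M = add_mset z M'" by (meson multiset_cases)
    show ?thesis
    proof (cases "cnj z = z")
      case True
      then obtain x where x: "z = complex_of_real x"
        by (metis Reals_cnj_iff Reals_cases)
      from less(2) have "image_mset cnj M' = M'" by (simp add: M True)
      moreover have "size M' < size M" by (simp add: M)
      ultimately obtain p where p: "real_to_cpoly p = (\<Prod>z\<in>#M'. [:- z, 1:])" "degree p = size M'" "lead_coeff p = 1"
        "(\<forall>z\<in>#M'. Re z < 0) \<longrightarrow> (\<forall>i. coeff p i \<ge> 0)"
        using less(1)[of M'] \<open>size M' < size M\<close> by blast
      let ?q = "[:- x, 1:]"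
      have q_nonneg: "coeff ?q i \<ge> 0" if "Re z < 0" for i
        using that by (auto simp: x coeff_pCons split: nat.splits)
      have "p \<noteq> 0" using p(3) by auto
      show ?thesis
      proof (intro exI[of _ "?q * p"] conjI impI allI)
        show "real_to_cpoly (?q * p) = (\<Prod>z\<in>#M. [:- z, 1:])"
          by (simp add: M x real_to_cpoly_mult p(1) map_poly_pCons del: mult_pCons_left mult_pCons_right)
        show "degree (?q * p) = size M"
          using \<open>p \<noteq> 0\<close> p(2) by (simp add: degree_mult_eq M del: mult_pCons_left)
        show "lead_coeff (?q * p) = 1"
          unfolding lead_coeff_mult using p(3) by simp
        show "coeff (?q * p) i \<ge> 0" if "\<forall>z\<in>#M. Re z < 0" for i
          using that p(4) by (intro mult q_nonneg) (auto simp: M)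
      qed
    next
      case False
      have "cnj z \<in># image_mset cnj M" by (simp add: M)
      then have "cnj z \<in># M" unfolding less(2) .
      then have "cnj z \<in># M'" using False by (simp add: M)
      then obtain N where N: "M' = add_mset (cnj z) N" by (meson mset_add)
      from less(2) have "image_mset cnj N = N" by (simp add: M N)
      moreover have "size N < size M" by (simp add: M N)
      ultimately obtain p where p: "real_to_cpoly p = (\<Prod>z\<in>#N. [:- z, 1:])" "degree p = size N" "lead_coeff p = 1"
        "(\<forall>z\<in>#N. Re z < 0) \<longrightarrow> (\<forall>i. coeff p i \<ge> 0)"
        using less(1)[of N] \<open>size N < size M\<close> by blast
      let ?q = "[:(cmod z)\<^sup>2, - 2 * Re z, 1:]"
      have q: "real_to_cpoly ?q = [:- z, 1:] * [:- cnj z, 1:]"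
        using complex_norm_square[of z] complex_add_cnj[of z]
        by (simp add: map_poly_pCons algebra_simps)
      have q_nonneg: "coeff ?q i \<ge> 0" if "Re z < 0" for i
        using that by (auto simp: coeff_pCons split: nat.splits)
      have "p \<noteq> 0" using p(3) by auto
      show ?thesis
      proof (intro exI[of _ "?q * p"] conjI impI allI)
        show "real_to_cpoly (?q * p) = (\<Prod>z\<in>#M. [:- z, 1:])"
          unfolding real_to_cpoly_mult p(1) q by (simp add: M N mult.assoc del: mult_pCons_left mult_pCons_right)
        show "degree (?q * p) = size M"
          using \<open>p \<noteq> 0\<close> p(2) by (simp add: degree_mult_eq M N del: mult_pCons_left)
        show "lead_coeff (?q * p) = 1"
          unfolding lead_coeff_mult using p(3) by simp
        show "coeff (?q * p) i \<ge> 0" if "\<forall>z\<in>#M. Re z < 0" for i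
          using that p(4) by (intro mult q_nonneg) (auto simp: M N)
      qed
    qed
  qed
qed

lemma cnj_closed_real_poly:
  assumes "cnj_closed zs"
  obtains p :: "real poly" where "real_to_cpoly p = (\<Prod>z\<leftarrow>zs. [:- z, 1:])" "degree p = length zs" "lead_coeff p = 1"
    "stable_poles zs \<Longrightarrow> (\<forall>i. coeff p i \<ge> 0)"
proof -
  have "image_mset cnj (mset zs) = mset zs"
    using assms by (simp add: cnj_closed_def)
  then obtain p :: "real poly" where "real_to_cpoly p = (\<Prod>z\<in>#mset zs. [:- z, 1:])" "degree p = size (mset zs)"
    "lead_coeff p = 1" "(\<forall>z\<in>#mset zs. Re z < 0) \<longrightarrow> (\<forall>i. coeff p i \<ge> 0)"
    using cnj_multiset_real_poly by blast
  then show ?thesis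
    by (intro that[of p]) (auto simp: stable_poles_def prod_mset_prod_list simp flip: mset_map)
qed

lemma prod_list_linear_poly: "(\<Prod>p\<leftarrow>ps. s - p) = poly (\<Prod>p\<leftarrow>ps. [:- p, 1:]) (s :: 'a :: comm_ring_1)"
  by (induction ps) (auto simp: algebra_simps)

section \<open>Quantitative positivity and small shifts\<close>

text \<open>For large \<open>x\<close> the leading term gives the bound; on the remaining compact
  interval the quotient by the sum of powers attains a positive minimum. The constant
  \<open>c\<close> is the room for perturbing all coefficients of \<open>P\<close> at once.\<close>

lemma poly_dominates_powers:
  fixes P :: "real poly"
  assumes lead: "lead_coeff P > 0" and pos: "\<And>x. x \<ge> 0 \<Longrightarrow> poly P x > 0"
  obtains c where "c > 0" "\<And>x. x \<ge> 0 \<Longrightarrow> poly P x \<ge> c * (\<Sum>j\<le>degree P. x ^ j)"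
proof -
  define R :: "real poly" where "R = (\<Sum>j\<le>degree P. monom 1 j)"
  have R: "poly R x = (\<Sum>j\<le>degree P. x ^ j)" for x
    by (simp add: R_def poly_sum poly_monom)
  have Rpos: "poly R x > 0" if "x \<ge> 0" for x
    unfolding R using that by (intro sum_pos2[of _ 0]) auto
  \<comment> \<open>Half the leading coefficient, so that \<open>?D\<close> below still has a
    positive leading coefficient.\<close>
  let ?l = "lead_coeff P / 2"
  have cR: "coeff R i = (if i \<le> degree P then 1 else 0)" for i
    by (simp add: R_def coeff_sum)
  let ?D = "P - smult ?l R"
  have "coeff ?D (degree P) > 0" using lead by (simp add: cR)
  moreover have "coeff ?D i = 0" if "i > degree P" for i
    using that by (simp add: cR coeff_eq_0)
  ultimately have "lead_coeff ?D > 0"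
    by (metis degree_le le_antisym le_degree less_irrefl)
  then obtain X where X: "\<And>x. x \<ge> X \<Longrightarrow> poly ?D x \<ge> 0"
    using poly_pinfty_gt_lc[of ?D] by (meson less_imp_le order_trans)
  let ?f = "\<lambda>x. poly P x / poly R x"
  have "continuous_on {0..max X 0} ?f"
    using Rpos by (intro continuous_intros) (metis atLeastAtMost_iff less_irrefl)
  then obtain x0 where x0: "x0 \<in> {0..max X 0}" "\<And>x. x \<in> {0..max X 0} \<Longrightarrow> ?f x0 \<le> ?f x"
    using continuous_attains_inf[of "{0..max X 0}" ?f] by auto
  show ?thesis
  proof (rule that[of "min ?l (?f x0)"])
    show "min ?l (?f x0) > 0" using lead pos Rpos x0(1) by simp
    fix x :: real assume x: "x \<ge> 0"
    show "poly P x \<ge> min ?l (?f x0) * (\<Sum>j\<le>degree P. x ^ j)"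
    proof (cases "x \<le> max X 0")
      case True
      then have "min ?l (?f x0) \<le> ?f x" using x0(2)[of x] x by auto
      with Rpos[OF x] show ?thesis unfolding R[symmetric] by (simp add: le_divide_eq)
    next
      case False
      then have "poly ?D x \<ge> 0" using X[of x] by auto
      then have "poly P x \<ge> ?l * poly R x" by simp
      also have "?l * poly R x \<ge> min ?l (?f x0) * poly R x"
        using Rpos[OF x] by (intro mult_right_mono min.cobounded1) simp
      finally show ?thesis unfolding R .
    qed
  qed
qed

text \<open>Induction along Horner's scheme: the shift of \<open>a + s * p(s)\<close> is
  \<open>a + (s - l) * p(s - l)\<close>.\<close>

lemma coeff_shift_tendsto:
  fixes p :: "real poly"
  shows "((\<lambda>l. coeff (pcompose p [:- l, 1:]) j) \<longlongrightarrow> coeff p j) (at 0)"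
proof (induction p arbitrary: j)
  case 0
  show ?case by simp
next
  case (pCons a p)
  show ?case
  proof (cases j)
    case 0
    have "((\<lambda>l. a - l * coeff (pcompose p [:- l, 1:]) 0) \<longlongrightarrow> a - 0 * coeff p 0) (at 0)"
      by (intro tendsto_intros pCons)
    then show ?thesis by (simp add: 0 pcompose_pCons)
  next
    case (Suc i)
    have "((\<lambda>l. - l * coeff (pcompose p [:- l, 1:]) (Suc i) + coeff (pcompose p [:- l, 1:]) i) \<longlongrightarrow>
        - 0 * coeff p (Suc i) + coeff p i) (at 0)"
      by (intro tendsto_intros pCons)
    then show ?thesis by (simp add: Suc pcompose_pCons)
  qed
qed

lemma poly_eq_sum_lessThan:
  fixes p :: "'a :: comm_ring_1 poly"
  assumes "degree p < n"
  shows "poly p x = (\<Sum>j<n. coeff p j * x ^ j)"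
proof -
  have "poly p x = (\<Sum>j\<le>degree p. coeff p j * x ^ j)" by (rule poly_altdef)
  also have "\<dots> = (\<Sum>j<n. coeff p j * x ^ j)"
    using assms by (intro sum.mono_neutral_left) (auto simp: coeff_eq_0)
  finally show ?thesis .
qed

subsection \<open>Responses with all poles at one point\<close>

text \<open>The impulse response of \<open>b(s) / s\<^sup>n\<close>: the term of exponent
  \<open>j\<close> contributes \<open>1 / s\<^sup>n\<^sup>-\<^sup>j\<close>, the transform of the
  monomial in the sum.\<close>

definition integrator_response :: "nat \<Rightarrow> real poly \<Rightarrow> real \<Rightarrow> real" where
  "integrator_response n b t = (\<Sum>j<n. coeff b j * (t ^ (n - 1 - j) / fact (n - 1 - j)))"

text \<open>Real counterpart of \<open>B_tilde\<close>, indexed by the exponent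
  \<open>j = n - i\<close>, which turns \<open>i - 1\<close> into \<open>n - 1 - j\<close>.\<close>

definition real_B_tilde :: "nat \<Rightarrow> real poly \<Rightarrow> real poly" where
  "real_B_tilde n b = (\<Sum>j<n. monom (coeff b j / fact (n - 1 - j)) j)"

lemma coeff_real_B_tilde: "coeff (real_B_tilde n b) j = (if j < n then coeff b j / fact (n - 1 - j) else 0)"
  by (simp add: real_B_tilde_def coeff_sum)

lemma poly_real_B_tilde: "poly (real_B_tilde n b) x = (\<Sum>j<n. coeff b j / fact (n - 1 - j) * x ^ j)"
  by (simp add: real_B_tilde_def poly_sum poly_monom)

lemma degree_real_B_tilde:
  assumes "degree b < n"
  shows "degree (real_B_tilde n b) = degree b"
proof (cases "b = 0")
  case False
  show ?thesis
  proof (rule antisym)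
    show "degree (real_B_tilde n b) \<le> degree b"
      by (rule degree_le) (auto simp: coeff_real_B_tilde coeff_eq_0)
    show "degree b \<le> degree (real_B_tilde n b)"
      by (rule le_degree) (use assms False in \<open>auto simp: coeff_real_B_tilde\<close>)
  qed
qed (simp add: real_B_tilde_def)

lemma lead_coeff_real_B_tilde:
  assumes "degree b < n"
  shows "lead_coeff (real_B_tilde n b) = lead_coeff b / fact (n - 1 - degree b)"
  using assms by (simp add: degree_real_B_tilde coeff_real_B_tilde)

lemma B_tilde_real: "B_tilde n (real_to_cpoly b) = real_to_cpoly (real_B_tilde n b)"
proof -
  have "B_tilde n (real_to_cpoly b) = (\<Sum>j<n. monom (complex_of_real (coeff b j) / fact (n - 1 - j)) j)"
    unfolding B_tilde_def
    by (rule sum.reindex_bij_witness[of _ "\<lambda>j. n - j" "\<lambda>i. n - i"]) (auto simp: coeff_map_poly)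
  also have "\<dots> = real_to_cpoly (real_B_tilde n b)"
    by (rule poly_eqI) (simp add: coeff_sum coeff_map_poly coeff_real_B_tilde)
  finally show ?thesis .
qed

text \<open>Pulling out \<open>t ^ (n - 1)\<close> leaves powers of \<open>1 / t\<close>. Thus
  \<open>x = 1 / t\<close> matches positive roots of the polynomial with positive zeros of the
  response; the point \<open>x = 0\<close> is out of reach and is treated apart.\<close>

lemma integrator_response_eq_B_tilde:
  assumes "t > 0"
  shows "integrator_response n b t = t ^ (n - 1) * poly (real_B_tilde n b) (1 / t)"
proof -
  have pw: "t ^ (n - 1 - j) = t ^ (n - 1) * (1 / t) ^ j" if "j < n" for j
    using that assms by (simp add: power_diff power_one_over)
  show ?thesis
    unfolding integrator_response_def poly_real_B_tilde sum_distrib_left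
  proof (intro sum.cong refl)
    fix j assume "j \<in> {..<n}"
    then show "coeff b j * (t ^ (n - 1 - j) / fact (n - 1 - j)) =
        t ^ (n - 1) * (coeff b j / fact (n - 1 - j) * (1 / t) ^ j)"
      by (simp only: pw lessThan_iff) simp
  qed
qed

lemma continuous_on_integrator_response: "continuous_on S (integrator_response n b)"
  unfolding integrator_response_def by (intro continuous_intros) auto

text \<open>Damping by \<open>exp (- (l * t))\<close> replaces \<open>s\<close> by
  \<open>s + l\<close> in the transform, which moves the n-fold pole from 0 to
  \<open>- l\<close>.\<close>

lemma integrator_response_damped_laplace:
  assumes b: "degree b < n"
  shows "has_laplace_transform (\<lambda>t. exp (- (l * t)) * integrator_response n b t)
    (\<lambda>s. poly (real_to_cpoly b) (s + complex_of_real l) / (s + complex_of_real l) ^ n)"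
  unfolding has_laplace_transform_def
proof (intro exI[of _ "- l"] allI impI)
  fix s :: complex assume "Re s > - l"
  define w where "w = s + complex_of_real l"
  with \<open>Re s > - l\<close> have w: "Re w > 0" by simp
  then have w0: "w \<noteq> 0" by auto
  have "((\<lambda>t. \<Sum>j<n. complex_of_real (coeff b j) *
      (exp (- (w * complex_of_real t)) * (complex_of_real t ^ (n - 1 - j) / fact (n - 1 - j))))
      has_integral (\<Sum>j<n. complex_of_real (coeff b j) * (1 / w ^ Suc (n - 1 - j)))) {0..}"
    by (intro has_integral_sum has_integral_mult_right monomial_exp_has_integral w) auto
  also have "(\<lambda>t. \<Sum>j<n. complex_of_real (coeff b j) *
      (exp (- (w * complex_of_real t)) * (complex_of_real t ^ (n - 1 - j) / fact (n - 1 - j)))) =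
      (\<lambda>t. exp (- (s * complex_of_real t)) * complex_of_real (exp (- (l * t)) * integrator_response n b t))"
    unfolding fun_eq_iff
  proof
    fix t
    have "exp (- (w * complex_of_real t)) = exp (- (s * complex_of_real t)) * exp (- complex_of_real (l * t))"
      unfolding exp_add[symmetric] by (simp add: w_def algebra_simps)
    also have "exp (- complex_of_real (l * t)) = complex_of_real (exp (- (l * t)))"
      by (simp only: exp_of_real[symmetric] of_real_minus)
    finally show "(\<Sum>j<n. complex_of_real (coeff b j) *
        (exp (- (w * complex_of_real t)) * (complex_of_real t ^ (n - 1 - j) / fact (n - 1 - j)))) =
        exp (- (s * complex_of_real t)) * complex_of_real (exp (- (l * t)) * integrator_response n b t)"
      by (simp add: integrator_response_def sum_distrib_left mult_ac)
  qed
  also have "(\<Sum>j<n. complex_of_real (coeff b j) * (1 / w ^ Suc (n - 1 - j))) =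
      (\<Sum>j<n. coeff (real_to_cpoly b) j * w ^ j) / w ^ n"
    unfolding sum_divide_distrib
  proof (intro sum.cong refl)
    fix j assume "j \<in> {..<n}"
    then have "w ^ n = w ^ j * w ^ Suc (n - 1 - j)" by (simp flip: power_add power_Suc)
    then show "complex_of_real (coeff b j) * (1 / w ^ Suc (n - 1 - j)) = coeff (real_to_cpoly b) j * w ^ j / w ^ n"
      using w0 by (simp add: coeff_map_poly)
  qed
  also have "(\<Sum>j<n. coeff (real_to_cpoly b) j * w ^ j) = poly (real_to_cpoly b) w"
    by (rule poly_eq_sum_lessThan[symmetric]) (use b in \<open>simp add: degree_map_poly\<close>)
  finally show "((\<lambda>t. exp (- (s * complex_of_real t)) * complex_of_real (exp (- (l * t)) * integrator_response n b t))
      has_integral poly (real_to_cpoly b) (s + complex_of_real l) / (s + complex_of_real l) ^ n) {0..}"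
    by (simp add: w_def)
qed

lemma integrator_response_laplace:
  assumes b: "degree b < n"
  shows "real_laplace (integrator_response n b) (\<lambda>s. \<Sum>j<n. coeff b j * (1 / s ^ Suc (n - 1 - j)))"
  unfolding integrator_response_def
  by (intro real_laplace_sum real_laplace_cmult real_laplace_monomial) auto

lemma has_laplace_transform_real:
  assumes "has_laplace_transform h H"
  shows "real_laplace h (\<lambda>s. Re (H (complex_of_real s)))"
proof -
  obtain \<sigma> where \<sigma>: "\<And>s. Re s > \<sigma> \<Longrightarrow>
      ((\<lambda>t. exp (- (s * complex_of_real t)) * complex_of_real (h t)) has_integral H s) {0..}"
    using assms unfolding has_laplace_transform_def by blast
  show ?thesis unfolding real_laplace_def
  proof (intro exI[of _ \<sigma>] allI impI)
    fix s assume "s > \<sigma>"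
    from has_integral_Re[OF \<sigma>[of "complex_of_real s"]] this
    have "((\<lambda>t. Re (complex_of_real (exp (- (s * t)) * h t))) has_integral Re (H (complex_of_real s))) {0..}"
      by (simp only: exp_of_real[symmetric] of_real_mult of_real_minus Re_complex_of_real)
    then show "((\<lambda>t. exp (- (s * t)) * h t) has_integral Re (H (complex_of_real s))) {0..}"
      by (simp only: Re_complex_of_real)
  qed
qed

lemma real_laplace_cong:
  assumes "real_laplace f F" "\<And>s. s > a \<Longrightarrow> F s = G s"
  shows "real_laplace f G"
proof -
  obtain \<sigma> where \<sigma>: "\<And>s. s > \<sigma> \<Longrightarrow> ((\<lambda>t. exp (- (s * t)) * f t) has_integral F s) {0..}"
    using assms(1) unfolding real_laplace_def by blast
  have "((\<lambda>t. exp (- (s * t)) * f t) has_integral G s) {0..}" if "s > max \<sigma> a" for s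
    using \<sigma>[of s] assms(2)[of s] that by simp
  then show ?thesis unfolding real_laplace_def by blast
qed

section \<open>Iterated integrals of a nonnegative response\<close>

context
  fixes h :: "real \<Rightarrow> real"
  assumes h_cont: "continuous_on {0..} h" and h_nonneg: "\<And>t. t \<ge> 0 \<Longrightarrow> h t \<ge> 0"
begin

lemma iterated_primitive_continuous: "continuous_on {0..} ((primitive ^^ k) h)"
  by (induction k) (auto intro: h_cont continuous_on_primitive)

lemma iterated_primitive_nonneg: "t \<ge> 0 \<Longrightarrow> (primitive ^^ k) h t \<ge> 0"
  by (induction k arbitrary: t) (auto intro!: h_nonneg primitive_nonneg[OF iterated_primitive_continuous])

text \<open>The count starts at one integration because \<open>h\<close> itself has no known growth
  bound; nonnegativity supplies one for its first primitive, and later primitives inherit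
  it.\<close>

lemma iterated_primitive_laplace:
  assumes "real_laplace h F"
  shows "exp_order ((primitive ^^ Suc k) h) \<and> real_laplace ((primitive ^^ Suc k) h) (\<lambda>s. F s / s ^ Suc k)"
proof (induction k)
  case 0
  show ?case
    using exp_order_primitive_nonneg[OF h_cont h_nonneg assms]
      real_laplace_primitive[OF h_cont _ assms] by simp
next
  case (Suc k)
  then have 1: "exp_order ((primitive ^^ Suc (Suc k)) h)"
    using exp_order_primitive[OF iterated_primitive_continuous[of "Suc k"]] by simp
  from Suc real_laplace_primitive[OF iterated_primitive_continuous[of "Suc k"], of "\<lambda>s. F s / s ^ Suc k"] 1
  have "real_laplace ((primitive ^^ Suc (Suc k)) h) (\<lambda>s. F s / s ^ Suc k / s)" by simp
  with 1 show ?case by (simp add: ac_simps)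
qed

text \<open>A continuous nonnegative function with zero integral over \<open>[0, t]\<close> vanishes
  there, so vanishing on the whole interval passes between iterates in both directions.\<close>

lemma iterated_primitive_eq_0_iff:
  assumes "t > 0"
  shows "(\<forall>x\<in>{0..t}. (primitive ^^ k) h x = 0) \<longleftrightarrow> (\<forall>x\<in>{0..t}. h x = 0)"
proof (induction k)
  case (Suc k)
  have "primitive ((primitive ^^ k) h) t = 0 \<longleftrightarrow> (\<forall>x\<in>{0..t}. (primitive ^^ k) h x = 0)"
    unfolding primitive_def[of _ t]
    by (intro integral_eq_0_iff continuous_on_subset[OF iterated_primitive_continuous])
      (auto simp: iterated_primitive_nonneg assms)
  moreover have "primitive ((primitive ^^ k) h) x = 0" if "\<forall>x\<in>{0..t}. (primitive ^^ k) h x = 0" "x \<in> {0..t}" for x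
  proof -
    have "primitive ((primitive ^^ k) h) x = integral {0..x} (\<lambda>_. 0)"
      unfolding primitive_def[of _ x] by (intro integral_cong) (use that in auto)
    then show ?thesis by simp
  qed
  ultimately show ?case using Suc assms by auto
qed simp

text \<open>Since \<open>b / s\<^sup>n = (b / d) \<cdot> (d / s\<^sup>n)\<close>, the response with all poles moved to the origin is a
  combination of iterated integrals of \<open>h\<close>. The comparison of transforms is made after one further
  integration, where the functions are of exponential order.\<close>

lemma integrator_response_eq_iterated_primitives:
  fixes b d :: "real poly"
  assumes b: "degree b < n" and d: "degree d = n" "lead_coeff d = 1" "\<And>i. coeff d i \<ge> 0"
    and L: "real_laplace h (\<lambda>s. poly b s / poly d s)" and t: "t > 0"
  shows "integrator_response n b t = (\<Sum>j\<le>n. coeff d j * (primitive ^^ (n - j)) h t)"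
proof -
  let ?I = "\<lambda>k. (primitive ^^ k) h"
  \<comment> \<open>\<open>Suc n\<close> adds one integration: this is the impulse response of
    \<open>b(s) / s\<^sup>n\<^sup>+\<^sup>1\<close>, matching the extra \<open>Suc\<close> in
    \<open>?q\<close>.\<close>
  let ?r = "integrator_response (Suc n) b"
  let ?q = "\<lambda>t. \<Sum>j\<le>n. coeff d j * ?I (Suc (n - j)) t"
  let ?f = "\<lambda>t. ?r t + (-1) * ?q t"
  have zero: "?f t = 0" if "t \<ge> 0" for t
  proof (rule lerch[OF _ _ _ that])
    show "continuous_on {0..} ?f"
      by (intro continuous_intros continuous_on_integrator_response iterated_primitive_continuous)
    have "exp_order ?r"
      unfolding integrator_response_def
      using exp_order_cmult[OF exp_order_power, of "coeff b _ / fact _"]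
      by (intro exp_order_sum) (simp_all add: mult.commute)
    then show "exp_order ?f"
      using iterated_primitive_laplace[OF L]
      by (intro exp_order_add exp_order_cmult exp_order_sum) auto
    have "real_laplace ?f (\<lambda>s. (\<Sum>j<Suc n. coeff b j * (1 / s ^ Suc (Suc n - 1 - j))) +
        (-1) * (\<Sum>j\<le>n. coeff d j * (poly b s / poly d s / s ^ Suc (n - j))))"
      using iterated_primitive_laplace[OF L] b
      by (intro real_laplace_add real_laplace_cmult real_laplace_sum integrator_response_laplace) auto
    \<comment> \<open>On \<open>s > 0\<close> the monic \<open>d\<close> with nonnegative
      coefficients is positive, so it cancels in the product of \<open>b / d\<close> and
      \<open>d / s\<^sup>n\<^sup>+\<^sup>1\<close>.\<close>
    then show "real_laplace ?f (\<lambda>s. 0)"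
    proof (rule real_laplace_cong)
      fix s :: real assume s: "s > 0"
      have pd: "poly d s > 0"
      proof -
        have "poly d s = (\<Sum>j\<le>n. coeff d j * s ^ j)" using d(1) by (simp add: poly_altdef)
        also have "\<dots> > 0"
          by (rule sum_pos2[of _ n]) (use s d in auto)
        finally show ?thesis .
      qed
      have pw: "1 / s ^ Suc (n - j) = s ^ j / s ^ Suc n" if "j \<le> n" for j
        using that s by (simp add: field_simps flip: power_add)
      have "(\<Sum>j<Suc n. coeff b j * (1 / s ^ Suc (Suc n - 1 - j))) = (\<Sum>j<Suc n. coeff b j * s ^ j) / s ^ Suc n"
        unfolding sum_divide_distrib using pw by (intro sum.cong refl) (simp del: power_Suc)
      also have "\<dots> = poly b s / s ^ Suc n"
        using b poly_eq_sum_lessThan[of b "Suc n"] by simp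
      finally have 1: "(\<Sum>j<Suc n. coeff b j * (1 / s ^ Suc (Suc n - 1 - j))) = poly b s / s ^ Suc n" .
      have "(\<Sum>j\<le>n. coeff d j * (poly b s / poly d s / s ^ Suc (n - j))) =
          (\<Sum>j\<le>n. poly b s / poly d s * (coeff d j * (1 / s ^ Suc (n - j))))"
        by (simp add: field_simps)
      also have "\<dots> = (\<Sum>j\<le>n. poly b s / poly d s * (coeff d j * (s ^ j / s ^ Suc n)))"
        by (intro sum.cong refl) (simp only: pw atMost_iff)
      also have "\<dots> = poly b s / poly d s * (\<Sum>j\<le>n. coeff d j * s ^ j) / s ^ Suc n"
        by (simp add: sum_distrib_left sum_divide_distrib mult.assoc)
      also have "(\<Sum>j\<le>n. coeff d j * s ^ j) = poly d s" using d(1) by (simp add: poly_altdef)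
      finally show "(\<Sum>j<Suc n. coeff b j * (1 / s ^ Suc (Suc n - 1 - j))) +
        (-1) * (\<Sum>j\<le>n. coeff d j * (poly b s / poly d s / s ^ Suc (n - j))) = 0"
        unfolding 1 using pd by simp
    qed
  qed
  \<comment> \<open>The extra integration is now undone by differentiating both sides at the
    interior point \<open>t\<close>.\<close>
  have at: "at t within {0..} = at t"
    using t by (intro at_within_interior) simp
  have I: "(?I (Suc k) has_real_derivative ?I k t) (at t)" for k
    using primitive_has_derivative[OF iterated_primitive_continuous[of k], of t] t at by simp
  have q: "(?q has_real_derivative (\<Sum>j\<le>n. coeff d j * ?I (n - j) t)) (at t)"
    by (intro DERIV_sum DERIV_cmult I)
  \<comment> \<open>At \<open>j = n\<close> the monomial is constant; the second branch records its
    zero derivative.\<close>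
  have D: "((\<lambda>t. coeff b j * (t ^ (n - j) / fact (n - j))) has_real_derivative
      (if j < n then coeff b j * (t ^ (n - 1 - j) / fact (n - 1 - j)) else 0)) (at t)" for j
  proof (cases "j < n")
    case True
    define k where "k = n - 1 - j"
    have k: "n - j = Suc k" "n - 1 - j = k" using True by (auto simp: k_def)
    have "((\<lambda>t. t ^ Suc k) has_real_derivative real (Suc k) * t ^ k) (at t)"
      using DERIV_pow[of "Suc k" t UNIV] by simp
    from DERIV_cmult[OF DERIV_cdivide[OF this, of "fact (Suc k)"], of "coeff b j"]
    have "((\<lambda>t. coeff b j * (t ^ Suc k / fact (Suc k))) has_real_derivative
        coeff b j * (real (Suc k) * t ^ k / fact (Suc k))) (at t)" .
    moreover have "real (Suc k) * t ^ k / fact (Suc k) = t ^ k / fact k"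
      by (simp del: of_nat_Suc)
    ultimately show ?thesis unfolding k using True by (simp only: if_True)
  qed simp
  have "((\<lambda>t. \<Sum>j<Suc n. coeff b j * (t ^ (n - j) / fact (n - j))) has_real_derivative
      (\<Sum>j<Suc n. if j < n then coeff b j * (t ^ (n - 1 - j) / fact (n - 1 - j)) else 0)) (at t)"
    by (intro DERIV_sum D)
  then have r: "(?r has_real_derivative integrator_response n b t) (at t)"
    by (simp add: integrator_response_def[abs_def])
  have "(?r has_real_derivative (\<Sum>j\<le>n. coeff d j * ?I (n - j) t)) (at t)"
    by (rule has_field_derivative_transform_within_open[OF q, of "{0<..}"]) (use zero t in auto)
  from DERIV_unique[OF r this] show ?thesis .
qed

text \<open>The representation by iterated primitives has nonnegative terms, so one zero of the sum
  kills each term. The vanishing spreads from \<open>t\<close> to \<open>[0, t]\<close> and back to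
  the response, contradicting \<open>b \<noteq> 0\<close>.\<close>

lemma integrator_response_nonzero:
  fixes b d :: "real poly"
  assumes "b \<noteq> 0" and b: "degree b < n" and d: "degree d = n" "lead_coeff d = 1" "\<And>i. coeff d i \<ge> 0" "coeff d 0 \<noteq> 0"
    and L: "real_laplace h (\<lambda>s. poly b s / poly d s)" and t: "t > 0"
  shows "integrator_response n b t \<noteq> 0"
proof
  note eq = integrator_response_eq_iterated_primitives[OF b d(1-3) L]
  assume "integrator_response n b t = 0"
  then have "(\<Sum>j\<le>n. coeff d j * (primitive ^^ (n - j)) h t) = 0" using eq[OF t] by simp
  then have "\<forall>j\<in>{..n}. coeff d j * (primitive ^^ (n - j)) h t = 0"
    using t by (subst (asm) sum_nonneg_eq_0_iff) (auto intro!: mult_nonneg_nonneg d iterated_primitive_nonneg)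
  \<comment> \<open>The term \<open>j = 0\<close> is the most integrated one: as an integral over
    \<open>[0, t]\<close>, its value at the single point \<open>t\<close> controls the whole
    interval.\<close>
  then have "(primitive ^^ n) h t = 0" using d(4) by auto
  moreover obtain k where k: "n = Suc k" using b by (cases n) auto
  ultimately have "integral {0..t} ((primitive ^^ k) h) = 0" by (simp add: primitive_def)
  moreover have "continuous_on {0..t} ((primitive ^^ k) h)"
    by (rule continuous_on_subset[OF iterated_primitive_continuous]) auto
  ultimately have "\<forall>x\<in>{0..t}. (primitive ^^ k) h x = 0"
    using integral_eq_0_iff[of 0 t "(primitive ^^ k) h"] t iterated_primitive_nonneg by auto
  then have "\<forall>x\<in>{0..t}. (primitive ^^ i) h x = 0" for i
    using iterated_primitive_eq_0_iff[OF t] by blast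
  then have r0: "integrator_response n b x = 0" if "0 < x" "x \<le> t" for x
    using eq[OF that(1)] that by simp
  \<comment> \<open>The interval \<open>0 < x \<le> t\<close> becomes the ray
    \<open>y \<ge> 1 / t\<close> under \<open>y = 1 / x\<close>, an infinite set of roots.\<close>
  have "poly (real_B_tilde n b) y = 0" if "y \<ge> 1 / t" for y
  proof -
    have "y > 0" using that t by (meson less_le_trans zero_less_divide_1_iff)
    then have "1 / y > 0" "1 / y \<le> t" using that t by (auto simp: field_simps)
    with r0[OF this] integrator_response_eq_B_tilde[of "1 / y" n b] show ?thesis by simp
  qed
  then have "{1 / t..} \<subseteq> {x. poly (real_B_tilde n b) x = 0}" by auto
  then have "infinite {x. poly (real_B_tilde n b) x = 0}"
    using infinite_Ici infinite_super by blast
  then have "real_B_tilde n b = 0" using poly_roots_finite by blast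
  then have "coeff b j = 0" for j
    using coeff_real_B_tilde[of n b j] b by (cases "j < n") (auto simp: coeff_eq_0)
  then show False using \<open>b \<noteq> 0\<close> by (simp add: poly_eq_iff)
qed

end

section \<open>Shifted numerators\<close>

lemma poly_real_to_cpoly_pcompose:
  "poly (real_to_cpoly (pcompose p [:- l, 1:])) (s + complex_of_real l) = poly (real_to_cpoly p) s"
proof (induction p)
  case (pCons a p)
  have "real_to_cpoly (u + v) = real_to_cpoly u + real_to_cpoly v" for u v
    by (rule poly_eqI) (simp add: coeff_map_poly)
  then have "real_to_cpoly (pcompose (pCons a p) [:- l, 1:]) =
      real_to_cpoly [:a:] + real_to_cpoly [:- l, 1:] * real_to_cpoly (pcompose p [:- l, 1:])"
    by (simp only: pcompose_pCons real_to_cpoly_mult)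
  then have "poly (real_to_cpoly (pcompose (pCons a p) [:- l, 1:])) (s + complex_of_real l) =
      complex_of_real a + s * poly (real_to_cpoly p) s"
    by (simp only: poly_add poly_mult pCons.IH) (simp add: map_poly_pCons)
  then show ?case by (simp add: map_poly_pCons)
qed simp

text \<open>For small \<open>l\<close> the shift changes each coefficient by less than the margin
  \<open>c\<close> of \<open>poly_dominates_powers\<close>, and dividing by factorials only shrinks
  the change. So the transformed polynomial stays nonnegative, and with it the response, through
  \<open>x = 1 / t\<close>.\<close>

lemma shifted_poly_response_nonneg:
  fixes b :: "real poly"
  assumes b: "degree b < n" "lead_coeff b > 0" and pos: "\<And>x. x \<ge> 0 \<Longrightarrow> poly (real_B_tilde n b) x > 0"
  obtains l where "l > 0" "\<And>t. t \<ge> 0 \<Longrightarrow> integrator_response n (pcompose b [:- l, 1:]) t \<ge> 0"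
proof -
  let ?m = "degree b"
  let ?s = "\<lambda>l. pcompose b [:- l, 1:]"
  have "lead_coeff (real_B_tilde n b) > 0"
    unfolding lead_coeff_real_B_tilde[OF b(1)] using b(2) by simp
  from poly_dominates_powers[OF this pos] obtain c where
    c: "c > 0" "\<And>x. x \<ge> 0 \<Longrightarrow> poly (real_B_tilde n b) x \<ge> c * (\<Sum>j\<le>?m. x ^ j)"
    unfolding degree_real_B_tilde[OF b(1)] by blast
  have "\<forall>\<^sub>F l in at 0. dist (coeff (?s l) j) (coeff b j) < c" for j
    by (rule tendstoD[OF coeff_shift_tendsto c(1)])
  then have "\<forall>\<^sub>F l in at 0. \<forall>j\<in>{..?m}. dist (coeff (?s l) j) (coeff b j) < c"
    by (intro eventually_ball_finite) auto
  \<comment> \<open>Approaching 0 from the right secures \<open>l > 0\<close>, so that a pole at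
    \<open>- l\<close> is stable.\<close>
  then have "\<forall>\<^sub>F l in at_right 0. \<forall>j\<in>{..?m}. dist (coeff (?s l) j) (coeff b j) < c"
    by (rule filter_leD[OF at_le, rotated]) simp
  moreover have "\<forall>\<^sub>F l::real in at_right 0. l > 0" by (rule eventually_at_right_less)
  ultimately have "\<forall>\<^sub>F l in at_right 0. l > 0 \<and> (\<forall>j\<in>{..?m}. dist (coeff (?s l) j) (coeff b j) < c)"
    by eventually_elim auto
  then have "\<exists>l. l > 0 \<and> (\<forall>j\<in>{..?m}. dist (coeff (?s l) j) (coeff b j) < c)"
    by (rule eventually_happens'[rotated]) simp
  then obtain l where l: "l > 0" "\<And>j. j \<le> ?m \<Longrightarrow> \<bar>coeff (?s l) j - coeff b j\<bar> < c"
    by (auto simp: dist_real_def)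
  have expand: "poly (real_B_tilde n p) x = (\<Sum>j\<le>?m. coeff p j / fact (n - 1 - j) * x ^ j)" if "degree p \<le> ?m" for p x
    unfolding poly_real_B_tilde using b that
    by (intro sum.mono_neutral_right) (auto simp: coeff_eq_0)
  have ge: "poly (real_B_tilde n (?s l)) x \<ge> 0" if x: "x \<ge> 0" for x
  proof -
    have "poly (real_B_tilde n b) x - poly (real_B_tilde n (?s l)) x =
        (\<Sum>j\<le>?m. (coeff b j - coeff (?s l) j) / fact (n - 1 - j) * x ^ j)"
      using expand[of b x] expand[of "?s l" x]
      by (simp add: degree_pcompose diff_divide_distrib left_diff_distrib sum_subtractf)
    also have "\<dots> \<le> (\<Sum>j\<le>?m. c * x ^ j)"
    proof (intro sum_mono mult_right_mono)
      fix j assume "j \<in> {..?m}"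
      then have "coeff b j - coeff (?s l) j \<le> c" using l(2)[of j] by auto
      also have "c * 1 \<le> c * fact (n - 1 - j)" using c(1) by (intro mult_left_mono) auto
      finally show "(coeff b j - coeff (?s l) j) / fact (n - 1 - j) \<le> c"
        by (simp add: pos_divide_le_eq)
    qed (use x in auto)
    also have "\<dots> \<le> poly (real_B_tilde n b) x" using c(2)[OF x] by (simp add: sum_distrib_left)
    finally show ?thesis by simp
  qed
  have "integrator_response n (?s l) t \<ge> 0" if t: "t > 0" for t
    using ge[of "1 / t"] t by (simp add: integrator_response_eq_B_tilde)
  \<comment> \<open>The substitution \<open>1 / t\<close> misses \<open>t = 0\<close>, which is
    reached by continuity.\<close>
  moreover have "integrator_response n (?s l) 0 \<ge> 0"
  proof (rule tendsto_lowerbound)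
    show "(integrator_response n (?s l) \<longlongrightarrow> integrator_response n (?s l) 0) (at_right 0)"
      using continuous_on_integrator_response[of UNIV n "?s l"]
      by (meson UNIV_I continuous_on_eq_continuous_at continuous_within isCont_def open_UNIV
          tendsto_within_subset top_greatest)
    show "\<forall>\<^sub>F t in at_right 0. integrator_response n (?s l) t \<ge> 0"
      using calculation by (auto simp: eventually_at_filter)
  qed simp
  ultimately have "integrator_response n (?s l) t \<ge> 0" if "t \<ge> 0" for t
    using that by (cases "t = 0") auto
  then show ?thesis using that l(1) by blast
qed

section \<open>Equivalence of pole placement and absence of nonnegative roots\<close>

theorem theorem1:
  fixes m n :: nat and K :: real and zs :: "complex list"
  assumes "n > m"
    and "K > 0"
    and "length zs = m"
    and "cnj_closed zs"
    and "\<forall>z\<in>set zs. z \<notin> complex_of_real ` {0..}"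
  shows "(\<exists>ps. length ps = n \<and> cnj_closed ps \<and> stable_poles ps \<and>
              externally_positive (transfer_function (numerator_poly K zs) ps))
         \<longleftrightarrow> \<not> (\<exists>x::real. x \<ge> 0 \<and> poly (B_tilde n (numerator_poly K zs)) (complex_of_real x) = 0)"
proof -
  obtain z where z: "real_to_cpoly z = (\<Prod>z\<leftarrow>zs. [:- z, 1:])" "degree z = length zs" "lead_coeff z = 1"
    using cnj_closed_real_poly[OF assms(4)] by metis
  define b where "b = smult K z"
  have B: "numerator_poly K zs = real_to_cpoly b"
    unfolding numerator_poly_def z(1)[symmetric] b_def
    by (rule poly_eqI) (simp add: coeff_map_poly)
  have b: "degree b < n" "lead_coeff b > 0" "b \<noteq> 0"
    using z(2,3) assms(1-3) by (auto simp: b_def)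
  have tilde: "poly (B_tilde n (numerator_poly K zs)) (complex_of_real x) = 0 \<longleftrightarrow> poly (real_B_tilde n b) x = 0" for x
    by (simp add: B B_tilde_real poly_real_to_cpoly)
  \<comment> \<open>The point \<open>x = 0\<close> corresponds to no \<open>t = 1 / x\<close>. There
    the value is, up to a positive factor, the product of the numbers \<open>- z\<close>, and 0 is
    not among the zeros.\<close>
  have tilde0: "poly (real_B_tilde n b) 0 \<noteq> 0"
  proof -
    have "complex_of_real (poly z 0) = (\<Prod>z\<leftarrow>zs. 0 - z)"
      unfolding prod_list_linear_poly[of 0] z(1)[symmetric] using poly_real_to_cpoly[of z 0] by simp
    moreover have "0 \<notin> set zs" using assms(5) by force
    ultimately have "poly z 0 \<noteq> 0" by (auto simp: prod_list_zero_iff)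
    then have "coeff b 0 \<noteq> 0" using assms(2) by (simp add: b_def poly_0_coeff_0)
    then show ?thesis using assms(1) by (simp add: poly_0_coeff_0 coeff_real_B_tilde)
  qed
  show ?thesis
  proof
    assume "\<exists>ps. length ps = n \<and> cnj_closed ps \<and> stable_poles ps \<and>
              externally_positive (transfer_function (numerator_poly K zs) ps)"
    then obtain ps h where ps: "length ps = n" "cnj_closed ps" "stable_poles ps"
      and h: "continuous_on {0..} h" "has_laplace_transform h (transfer_function (numerator_poly K zs) ps)"
        "\<And>t. t \<ge> 0 \<Longrightarrow> h t \<ge> 0"
      unfolding externally_positive_def impulse_response_def by blast
    obtain d where d: "real_to_cpoly d = (\<Prod>p\<leftarrow>ps. [:- p, 1:])" "degree d = n" "lead_coeff d = 1" "\<And>i. coeff d i \<ge> 0"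
      using cnj_closed_real_poly[OF ps(2)] ps(1,3) by metis
    have "transfer_function (numerator_poly K zs) ps (complex_of_real s) = complex_of_real (poly b s / poly d s)" for s
      by (simp add: transfer_function_def prod_list_linear_poly d(1)[symmetric] B poly_real_to_cpoly)
    then have L: "real_laplace h (\<lambda>s. poly b s / poly d s)"
      using has_laplace_transform_real[OF h(2)] by simp
    \<comment> \<open>Stable poles are nonzero, which gives the nonzero constant coefficient that
      \<open>integrator_response_nonzero\<close> asks for.\<close>
    have "complex_of_real (poly d 0) = (\<Prod>p\<leftarrow>ps. 0 - p)"
      unfolding prod_list_linear_poly[of 0] d(1)[symmetric] using poly_real_to_cpoly[of d 0] by simp
    moreover have "0 \<notin> set ps" using ps(3) by (auto simp: stable_poles_def)
    ultimately have d0: "coeff d 0 \<noteq> 0" by (auto simp: prod_list_zero_iff poly_0_coeff_0)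
    have "poly (real_B_tilde n b) x \<noteq> 0" if "x \<ge> 0" for x
    proof (cases "x = 0")
      case False
      then have x: "1 / x > 0" using that by simp
      from integrator_response_nonzero[OF h(1,3) b(3,1) d(2-4) d0 L x] integrator_response_eq_B_tilde[OF x]
      show ?thesis by auto
    qed (use tilde0 in simp)
    then show "\<not> (\<exists>x::real. x \<ge> 0 \<and> poly (B_tilde n (numerator_poly K zs)) (complex_of_real x) = 0)"
      by (simp add: tilde)
  next
    assume "\<not> (\<exists>x::real. x \<ge> 0 \<and> poly (B_tilde n (numerator_poly K zs)) (complex_of_real x) = 0)"
    then have nz: "poly (real_B_tilde n b) x \<noteq> 0" if "x \<ge> 0" for x
      using that by (auto simp: tilde)
    \<comment> \<open>With no nonnegative roots, the intermediate value theorem forces the sign of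
      the positive leading coefficient on all of \<open>x \<ge> 0\<close>.\<close>
    have "poly (real_B_tilde n b) x > 0" if x: "x \<ge> 0" for x
    proof (rule ccontr)
      have "lead_coeff (real_B_tilde n b) > 0"
        unfolding lead_coeff_real_B_tilde[OF b(1)] using b(2) by simp
      then obtain X where X: "\<And>y. y \<ge> X \<Longrightarrow> poly (real_B_tilde n b) y > 0"
        using poly_pinfty_gt_lc[of "real_B_tilde n b"] by (meson less_le_trans)
      assume "\<not> poly (real_B_tilde n b) x > 0"
      then have "poly (real_B_tilde n b) x < 0" using nz[OF x] by simp
      moreover have "poly (real_B_tilde n b) (max X (x + 1)) > 0" by (rule X) simp
      moreover have "x < max X (x + 1)" by (simp add: less_max_iff_disj)
      ultimately obtain y where "y > x" "poly (real_B_tilde n b) y = 0"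
        using poly_IVT_pos[of x "max X (x + 1)" "real_B_tilde n b"] by blast
      then show False using nz[of y] x by simp
    qed
    from shifted_poly_response_nonneg[OF b(1,2) this] obtain l where l: "l > 0"
      "\<And>t. t \<ge> 0 \<Longrightarrow> integrator_response n (pcompose b [:- l, 1:]) t \<ge> 0" by blast
    \<comment> \<open>All poles sit at \<open>- l\<close>: with the numerator rewritten in powers of
      \<open>s + l\<close>, the transfer function is the transform of the damped response
      \<open>?h\<close>.\<close>
    let ?ps = "replicate n (complex_of_real (- l))"
    let ?h = "\<lambda>t. exp (- (l * t)) * integrator_response n (pcompose b [:- l, 1:]) t"
    have "transfer_function (numerator_poly K zs) ?ps =
        (\<lambda>s. poly (real_to_cpoly (pcompose b [:- l, 1:])) (s + complex_of_real l) / (s + complex_of_real l) ^ n)"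
      by (simp add: fun_eq_iff transfer_function_def B poly_real_to_cpoly_pcompose prod_list_replicate)
    then have "has_laplace_transform ?h (transfer_function (numerator_poly K zs) ?ps)"
      using integrator_response_damped_laplace[of "pcompose b [:- l, 1:]" n l] b(1) by (simp add: degree_pcompose)
    moreover have "continuous_on {0..} ?h"
      by (intro continuous_intros continuous_on_integrator_response)
    ultimately have "externally_positive (transfer_function (numerator_poly K zs) ?ps)"
      unfolding externally_positive_def impulse_response_def using l(2) by (intro exI[of _ ?h]) auto
    moreover have "length ?ps = n" "cnj_closed ?ps" "stable_poles ?ps"
      using l(1) by (auto simp: cnj_closed_def stable_poles_def)
    ultimately show "\<exists>ps. length ps = n \<and> cnj_closed ps \<and> stable_poles ps \<and>
              externally_positive (transfer_function (numerator_poly K zs) ps)" by blast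
  qed
qed

end
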